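(* Let $k,r\ge2$ be integers and let $\Gamma$ be the symmetric graph of type $k$ and order $r$ with vertex set $\mathcal V$. On finitely supported radial functions the spherical Fourier transform factors as the composition of the Abel transform and the Fourier transform on $\mathbb Z$: $$\mathcal H=\mathcal F\circ\mathcal A,$$ that is, $\mathcal Hf(\lambda)=\mathcal F(\mathcal Af)(\lambda)$ for all $f\in\mathcal D(\mathcal V)^{\sharp}$ and all $\lambda\in\mathbb C$.
   Context: Symmetric graph: $\Gamma$ is a connected graph in which every vertex $v$ belongs to exactly $r$ polygons with $k$ sides each (for $k=2$ a polygon is a single edge), these polygons having no side and no vertex in common except $v$, and such that every nontrivial loop runs through all the edges of at least one polygon. $\mathcal V$ is its vertex set. The distance $d(x,y)$ is the minimal number of polygons crossed by a path connecting $x$ with $y$. Fix an origin $o\in\mathcal V$ and put $|x|=d(x,o)$, $Q=(r-1)(k-1)$. The sphere $\{x:|x|=n\}$ has cardinality $\delta(n)$, with $\delta(0)=1$ and $\delta(n)=r(k-1)Q^{n-1}$ for $n\ge1$. Boundary: $\Omega$ is the set of geodesic rays starting at $o$; a ray $\omega$ is identified with its sequence of nodes $\omega_0=o,\omega_1,\omega_2,\dots$ in $\mathcal V$, with $d(\omega_i,\omega_j)=|i-j|$. For $x\in\mathcal V$ with $|x|=n$, $E(x)=\{\omega\in\Omega:\omega_n=x\}$; these sets form a base of the topology of $\Omega$, and $\nu$ is the Borel probability measure on $\Omega$ with $\nu(E(x))=1/\delta(|x|)$. The Busemann function is $\zeta(x,\omega)=d(o,\omega_m)-d(x,\omega_m)$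 for $m>|x|$ (independent of such $m$), the horocycles are $H_h(\omega)=\{x\in\mathcal V:\zeta(x,\omega)=h\}$, $h\in\mathbb Z$, and the Poisson kernel is $P(x,\omega)=Q^{\zeta(x,\omega)}$. A function on $\mathcal V$ is radial if it depends only on $|x|$; $\mathcal D(\mathcal V)^{\sharp}$ is the space of finitely supported radial functions. Abel transform: $\mathcal Af(h)=Q^{h/2}\sum_{x\in H_h(\omega)}f(x)$ for $f\in\mathcal D(\mathcal V)^{\sharp}$, independent of $\omega\in\Omega$. Spherical functions: $\varphi_\lambda(x)=\int_\Omega P(x,\omega)^{\frac12+i\lambda}\,d\nu(\omega)$, $\lambda\in\mathbb C$. Spherical Fourier transform: $\mathcal Hf(\lambda)=\sum_{x\in\mathcal V}f(x)\varphi_\lambda(x)$. Fourier transform on $\mathbb Z$: $\mathcal Fg(\lambda)=\sum_{n\in\mathbb Z}Q^{in\lambda}g(n)$. *)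

theory Defs
  imports "HOL-Probability.Probability"
begin

section \<open>Symmetric graphs\<close>

text \<open>A graph is a set \<open>V\<close> of vertices with a set \<open>E\<close> of two-element subsets of \<open>V\<close>;
  walks are lists of vertices.\<close>

definition walk_edges :: "'a list \<Rightarrow> 'a set list" where
  "walk_edges xs = map2 (\<lambda>x y. {x, y}) xs (tl xs)"

definition walk :: "'a set \<Rightarrow> 'a set set \<Rightarrow> 'a \<Rightarrow> 'a list \<Rightarrow> 'a \<Rightarrow> bool" where
  "walk V E x xs y \<longleftrightarrow>
     xs \<noteq> [] \<and> hd xs = x \<and> last xs = y \<and> set xs \<subseteq> V \<and> set (walk_edges xs) \<subseteq> E"

definition cycle_sides :: "'a list \<Rightarrow> 'a set list" where
  "cycle_sides c = walk_edges (c @ [hd c])"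

text \<open>Closed paths through the distinct vertices listed in \<open>c\<close>. A two-element list is allowed: it is
  the degenerate digon, whose two sides coincide as edges.\<close>

definition closed_path :: "'a set set \<Rightarrow> 'a list \<Rightarrow> bool" where
  "closed_path E c \<longleftrightarrow> length c \<ge> 2 \<and> distinct c \<and> set (cycle_sides c) \<subseteq> E"

text \<open>A polygon is represented by its set of sides, so that lists differing by rotation or reversal
  give the same polygon; for \<open>k = 2\<close> this set is a single edge.\<close>

definition polygons :: "'a set set \<Rightarrow> nat \<Rightarrow> 'a set set set" where
  "polygons E k = {set (cycle_sides c) | c. closed_path E c \<and> length c = k}"

text \<open>Nontrivial loops are taken to be the simple closed paths with at least three vertices (every
  loop that does not reduce to a point by cancelling backtracking contains one). The multiset
  inclusion in \<open>loops\<close> counts the edge of a digon twice, and a simple loop uses no edge twice, so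
  for \<open>k = 2\<close> the condition says that the graph is a tree; with plain inclusion of sets of edges it
  would be void. For \<open>k \<ge> 3\<close> the multisets have no repetitions.
  The assumption \<open>edges_covered\<close> is implicit in the description of the graph by its polygons: it
  excludes bridges belonging to no polygon.\<close>

locale symmetric_graph =
  fixes V :: "'a set" and E :: "'a set set" and k r :: nat
  assumes edges: "e \<in> E \<Longrightarrow> \<exists>x\<in>V. \<exists>y\<in>V. x \<noteq> y \<and> e = {x, y}"
    and connected: "x \<in> V \<Longrightarrow> y \<in> V \<Longrightarrow> \<exists>xs. walk V E x xs y"
    and edges_covered: "e \<in> E \<Longrightarrow> \<exists>p\<in>polygons E k. e \<in> p"
    and order: "v \<in> V \<Longrightarrow> card {p \<in> polygons E k. v \<in> \<Union>p} = r"
    and polygons_meet: "p \<in> polygons E k \<Longrightarrow> q \<in> polygons E k \<Longrightarrow> p \<noteq> q \<Longrightarrow>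
          v \<in> \<Union>p \<Longrightarrow> v \<in> \<Union>q \<Longrightarrow> p \<inter> q = {} \<and> \<Union>p \<inter> \<Union>q = {v}"
    and loops: "closed_path E c \<Longrightarrow> length c \<ge> 3 \<Longrightarrow>
          \<exists>c'. closed_path E c' \<and> length c' = k \<and> mset (cycle_sides c') \<subseteq># mset (cycle_sides c)"

text \<open>A polygon is crossed by a walk if the walk runs through one of its sides.\<close>

definition gdist :: "'a set \<Rightarrow> 'a set set \<Rightarrow> nat \<Rightarrow> 'a \<Rightarrow> 'a \<Rightarrow> nat" where
  "gdist V E k x y =
     (LEAST n. \<exists>xs. walk V E x xs y \<and>
        n = card {p \<in> polygons E k. p \<inter> set (walk_edges xs) \<noteq> {}})"

definition branching :: "nat \<Rightarrow> nat \<Rightarrow> nat" where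
  "branching k r = (r - 1) * (k - 1)"

definition sphere_size :: "nat \<Rightarrow> nat \<Rightarrow> nat \<Rightarrow> nat" where
  "sphere_size k r n = (if n = 0 then 1 else r * (k - 1) * branching k r ^ (n - 1))"

section \<open>The boundary\<close>

definition rays :: "'a set \<Rightarrow> 'a set set \<Rightarrow> nat \<Rightarrow> 'a \<Rightarrow> (nat \<Rightarrow> 'a) set" where
  "rays V E k v0 = {\<omega>. \<omega> 0 = v0 \<and> (\<forall>i. \<omega> i \<in> V) \<and>
     (\<forall>i j. int (gdist V E k (\<omega> i) (\<omega> j)) = \<bar>int i - int j\<bar>)}"

definition ray_cylinder :: "'a set \<Rightarrow> 'a set set \<Rightarrow> nat \<Rightarrow> 'a \<Rightarrow> 'a \<Rightarrow> (nat \<Rightarrow> 'a) set" where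
  "ray_cylinder V E k v0 x = {\<omega> \<in> rays V E k v0. \<omega> (gdist V E k x v0) = x}"

definition boundary_topology :: "'a set \<Rightarrow> 'a set set \<Rightarrow> nat \<Rightarrow> 'a \<Rightarrow> (nat \<Rightarrow> 'a) topology" where
  "boundary_topology V E k v0 = topology_generated_by (ray_cylinder V E k v0 ` V)"

definition is_boundary_measure ::
  "'a set \<Rightarrow> 'a set set \<Rightarrow> nat \<Rightarrow> nat \<Rightarrow> 'a \<Rightarrow> (nat \<Rightarrow> 'a) measure \<Rightarrow> bool" where
  "is_boundary_measure V E k r v0 \<nu> \<longleftrightarrow>
     prob_space \<nu> \<and>
     space \<nu> = rays V E k v0 \<and>
     sets \<nu> = sigma_sets (rays V E k v0) {U. openin (boundary_topology V E k v0) U} \<and>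
     (\<forall>x\<in>V. measure \<nu> (ray_cylinder V E k v0 x) = 1 / real (sphere_size k r (gdist V E k x v0)))"

text \<open>The Busemann function does not depend on the choice of an index \<open>m > d(x, v0)\<close>; the least one
  is used.\<close>

definition busemann :: "'a set \<Rightarrow> 'a set set \<Rightarrow> nat \<Rightarrow> 'a \<Rightarrow> 'a \<Rightarrow> (nat \<Rightarrow> 'a) \<Rightarrow> int" where
  "busemann V E k v0 x \<omega> =
     (let m = Suc (gdist V E k x v0)
      in int (gdist V E k v0 (\<omega> m)) - int (gdist V E k x (\<omega> m)))"

definition horocycle :: "'a set \<Rightarrow> 'a set set \<Rightarrow> nat \<Rightarrow> 'a \<Rightarrow> int \<Rightarrow> (nat \<Rightarrow> 'a) \<Rightarrow> 'a set" where
  "horocycle V E k v0 h \<omega> = {x \<in> V. busemann V E k v0 x \<omega> = h}"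

definition poisson :: "'a set \<Rightarrow> 'a set set \<Rightarrow> nat \<Rightarrow> nat \<Rightarrow> 'a \<Rightarrow> 'a \<Rightarrow> (nat \<Rightarrow> 'a) \<Rightarrow> real" where
  "poisson V E k r v0 x \<omega> = real (branching k r) powi busemann V E k v0 x \<omega>"

section \<open>Transforms\<close>

definition radial_fin :: "'a set \<Rightarrow> 'a set set \<Rightarrow> nat \<Rightarrow> 'a \<Rightarrow> ('a \<Rightarrow> complex) set" where
  "radial_fin V E k v0 = {f. finite {x \<in> V. f x \<noteq> 0} \<and>
     (\<forall>x\<in>V. \<forall>y\<in>V. gdist V E k x v0 = gdist V E k y v0 \<longrightarrow> f x = f y)}"

text \<open>The common value, for all rays, of the normalized horocyclic sums. In this and the following
  definitions the infinite sums have finitely many nonzero terms when \<open>f\<close> is finitely supported.\<close>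

definition abel ::
  "'a set \<Rightarrow> 'a set set \<Rightarrow> nat \<Rightarrow> nat \<Rightarrow> 'a \<Rightarrow> ('a \<Rightarrow> complex) \<Rightarrow> int \<Rightarrow> complex" where
  "abel V E k r v0 f h =
     (THE a. \<forall>\<omega>\<in>rays V E k v0.
        a = of_real (real (branching k r) powr (of_int h / 2)) *
              (\<Sum>\<^sub>\<infinity>x\<in>horocycle V E k v0 h \<omega>. f x))"

definition spherical ::
  "'a set \<Rightarrow> 'a set set \<Rightarrow> nat \<Rightarrow> nat \<Rightarrow> 'a \<Rightarrow> (nat \<Rightarrow> 'a) measure \<Rightarrow> complex \<Rightarrow> 'a \<Rightarrow> complex" where
  "spherical V E k r v0 \<nu> \<mu> x =
     (\<integral>\<omega>. complex_of_real (poisson V E k r v0 x \<omega>) powr (1 / 2 + \<i> * \<mu>) \<partial>\<nu>)"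

definition spherical_transform ::
  "'a set \<Rightarrow> 'a set set \<Rightarrow> nat \<Rightarrow> nat \<Rightarrow> 'a \<Rightarrow> (nat \<Rightarrow> 'a) measure \<Rightarrow>
     ('a \<Rightarrow> complex) \<Rightarrow> complex \<Rightarrow> complex" where
  "spherical_transform V E k r v0 \<nu> f \<mu> = (\<Sum>\<^sub>\<infinity>x\<in>V. f x * spherical V E k r v0 \<nu> \<mu> x)"

definition fourier_int :: "nat \<Rightarrow> (int \<Rightarrow> complex) \<Rightarrow> complex \<Rightarrow> complex" where
  "fourier_int q g \<mu> = (\<Sum>\<^sub>\<infinity>n\<in>UNIV. of_nat q powr (\<i> * of_int n * \<mu>) * g n)"

end

theory Submission
  imports Defs
begin

text \<open>For a ray \<open>\<omega>\<close>, grouping the vertices by horocycles turns \<open>\<Sum>x. f x * P(x, \<omega>)^(1/2 + i\<mu>)\<close> into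
  \<open>\<Sum>h. Q^(ih\<mu>) * Q^(h/2) * (\<Sum>x\<in>H_h(\<omega>). f x)\<close>, and integrating over the boundary gives the claim once
  the horocyclic sums are known not to depend on \<open>\<omega>\<close>. For \<open>|x| = n\<close> the Busemann function is
  \<open>n + 1 - d(x, \<omega>_(n+1))\<close>, so this follows from distance regularity: the number of \<open>x\<close> at distances
  \<open>a\<close> and \<open>b\<close> from \<open>o\<close> and \<open>y\<close> depends only on \<open>a\<close>, \<open>b\<close> and \<open>d(o, y)\<close>. Distance regularity
  in turn holds because every simple cycle is a polygon: each polygon \<open>p\<close> has a unique vertex through
  which any \<open>x\<close> reaches \<open>p\<close>, and exactly one of the polygons at \<open>y \<noteq> x\<close> is not first reached in \<open>y\<close>.\<close>

section \<open>Walks\<close>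

lemma walk_edges_simps [simp]:
  "walk_edges [] = []" "walk_edges [x] = []"
  "walk_edges (x # y # xs) = {x, y} # walk_edges (y # xs)"
  by (simp_all add: walk_edges_def)

lemma walk_edges_append:
  "walk_edges (xs @ y # ys) = walk_edges (xs @ [y]) @ walk_edges (y # ys)"
proof (induction xs)
  case (Cons a xs)
  then show ?case by (cases xs) auto
qed simp

lemma walk_edges_Cons: "xs \<noteq> [] \<Longrightarrow> walk_edges (x # xs) = {x, hd xs} # walk_edges xs"
  by (cases xs) auto

lemma walk_edges_snoc: "xs \<noteq> [] \<Longrightarrow> walk_edges (xs @ [x]) = walk_edges xs @ [{last xs, x}]"
  by (induction xs) (auto simp: walk_edges_Cons)

lemma set_walk_edges_rev: "set (walk_edges (rev xs)) = set (walk_edges xs)"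
proof (induction xs)
  case (Cons a xs)
  then show ?case
    by (cases "xs = []") (simp_all add: walk_edges_Cons walk_edges_snoc last_rev insert_commute)
qed simp

lemma walk_edges_subset: "e \<in> set (walk_edges xs) \<Longrightarrow> e \<subseteq> set xs"
proof (induction xs)
  case (Cons a xs)
  then show ?case by (cases xs) auto
qed simp

lemma Union_walk_edges: "length xs \<ge> 2 \<Longrightarrow> \<Union> (set (walk_edges xs)) = set xs"
proof (induction xs)
  case (Cons a xs)
  then show ?case
  proof (cases "length xs \<ge> 2")
    case True
    then have "xs \<noteq> []" by auto
    then show ?thesis using Cons.IH[OF True] by (auto simp: walk_edges_Cons)
  next
    case False
    then obtain b where "xs = [b]" using Cons.prems by (cases xs) (auto simp: not_le)
    then show ?thesis by simp
  qed
qed simp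

text \<open>Membership in \<open>X\<close> passes along each edge in both directions, so one vertex
  in \<open>X\<close> is enough. This is how the connectedness of a cycle is used below.\<close>

lemma walk_edges_closed:
  assumes "set xs \<inter> X \<noteq> {}" "\<And>e. e \<in> set (walk_edges xs) \<Longrightarrow> e \<inter> X \<noteq> {} \<Longrightarrow> e \<subseteq> X"
  shows "set xs \<subseteq> X"
  using assms
proof (induction xs)
  case (Cons a xs)
  show ?case
  proof (cases "xs = []")
    case False
    have edge: "{a, hd xs} \<inter> X \<noteq> {} \<Longrightarrow> {a, hd xs} \<subseteq> X"
      using Cons.prems(2) False by (auto simp: walk_edges_Cons)
    have hd: "hd xs \<in> set xs" using False by simp
    then have "set xs \<inter> X \<noteq> {}"
      using Cons.prems(1) edge by auto
    then have "set xs \<subseteq> X"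
      using Cons.IH Cons.prems(2) False by (auto simp: walk_edges_Cons)
    then show ?thesis using edge hd by auto
  qed (use Cons in auto)
qed simp

lemma walk_refl: "x \<in> V \<Longrightarrow> walk V F x [x] x"
  by (simp add: walk_def)

lemma walk_mono: "walk V F x xs y \<Longrightarrow> F \<subseteq> G \<Longrightarrow> walk V G x xs y"
  by (auto simp: walk_def)

lemma walk_rev: "walk V F x xs y \<Longrightarrow> walk V F y (rev xs) x"
  by (auto simp: walk_def set_walk_edges_rev hd_rev last_rev)

lemma walk_edges_join:
  assumes "xs \<noteq> []" "ys \<noteq> []" "last xs = hd ys"
  shows "walk_edges (xs @ tl ys) = walk_edges xs @ walk_edges ys"
proof -
  have "xs @ tl ys = butlast xs @ hd ys # tl ys"
    using assms by (metis append_butlast_last_id append_Cons append_assoc append_Nil)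
  also have "walk_edges \<dots> = walk_edges (butlast xs @ [hd ys]) @ walk_edges (hd ys # tl ys)"
    by (rule walk_edges_append)
  finally show ?thesis using assms by (metis append_butlast_last_id list.collapse)
qed

lemma walk_join:
  assumes "walk V F x xs y" "walk V F y ys z"
  shows "walk V F x (xs @ tl ys) z"
    and "set (walk_edges (xs @ tl ys)) = set (walk_edges xs) \<union> set (walk_edges ys)"
proof -
  show "set (walk_edges (xs @ tl ys)) = set (walk_edges xs) \<union> set (walk_edges ys)"
    using assms by (subst walk_edges_join) (auto simp: walk_def)
  then show "walk V F x (xs @ tl ys) z"
    using assms
    by (cases ys) (auto simp: walk_def last_append)
qed

lemma walk_split:
  assumes "walk V F x (ys @ u # zs) y"
  shows "walk V F x (ys @ [u]) u" "walk V F u (u # zs) y"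
  using assms walk_edges_append[of ys u zs] by (auto simp: walk_def hd_append split: if_splits)

text \<open>Cutting out the part between two occurrences of a repeated vertex shortens the walk,
  hence induction on the length.\<close>

lemma walk_distinct:
  assumes "walk V F x xs y"
  shows "\<exists>ys. walk V F x ys y \<and> distinct ys"
  using assms
proof (induction "length xs" arbitrary: xs rule: less_induct)
  case less
  show ?case
  proof (cases "distinct xs")
    case False
    then obtain as u bs cs where xs: "xs = as @ u # bs @ u # cs"
      using not_distinct_decomp[of xs] by auto
    have 1: "walk V F x (as @ [u]) u" using less.prems xs walk_split by metis
    have "walk V F x ((as @ u # bs) @ u # cs) y" using less.prems xs by simp
    then have 2: "walk V F u (u # cs) y" by (rule walk_split)
    have "walk V F x ((as @ [u]) @ cs) y" using walk_join(1)[OF 1 2] by simp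
    then show ?thesis using less.hyps xs by force
  qed (use less in auto)
qed

lemma walk_Union:
  assumes "walk V F x xs y" "x \<noteq> y"
  shows "set xs = \<Union> (set (walk_edges xs))" "length xs \<ge> 2" "set (walk_edges xs) \<noteq> {}"
proof -
  show "length xs \<ge> 2"
    using assms by (cases xs; cases "tl xs") (auto simp: walk_def)
  then show "set xs = \<Union> (set (walk_edges xs))" by (simp add: Union_walk_edges)
  then show "set (walk_edges xs) \<noteq> {}" using assms by (auto simp: walk_def)
qed

section \<open>Cycles\<close>

lemma Union_cycle_sides:
  assumes "length c \<ge> 2"
  shows "\<Union> (set (cycle_sides c)) = set c"
proof -
  have "\<Union> (set (cycle_sides c)) = set (c @ [hd c])"
    unfolding cycle_sides_def by (rule Union_walk_edges) (use assms in auto)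
  then show ?thesis using assms by (cases c) auto
qed

lemma mset_cycle_sides_rotate: "mset (cycle_sides (as @ v # bs)) = mset (cycle_sides (v # bs @ as))"
proof (cases as)
  case (Cons a as')
  have 1: "cycle_sides (as @ v # bs) = walk_edges (as @ [v]) @ walk_edges (v # bs @ [a])"
    using walk_edges_append[of as v "bs @ [a]"] Cons by (simp add: cycle_sides_def)
  have 2: "cycle_sides (v # bs @ as) = walk_edges (v # bs @ [a]) @ walk_edges (as @ [v])"
    using walk_edges_append[of "v # bs" a "as' @ [v]"] Cons by (simp add: cycle_sides_def)
  show ?thesis by (simp only: 1 2 mset_append add.commute)
qed simp

text \<open>With \<open>v\<close> rotated to the front, only the first and the last side contain it.
  For a digon they are the same edge, which the multiset counts twice.\<close>

lemma cycle_sides_degree: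
  assumes "distinct c" "length c \<ge> 2" "v \<in> set c"
  shows "size (filter_mset (\<lambda>e. v \<in> e) (mset (cycle_sides c))) = 2"
proof -
  obtain as bs where c: "c = as @ v # bs" using assms by (meson split_list)
  define ys where "ys = bs @ as"
  have ys: "ys \<noteq> []" "v \<notin> set ys" using assms c by (auto simp: ys_def)
  have "walk_edges (v # ys @ [v]) = {v, hd ys} # walk_edges ys @ [{last ys, v}]"
    using ys by (simp add: walk_edges_Cons walk_edges_snoc)
  moreover have "filter (\<lambda>e. v \<in> e) (walk_edges ys) = []"
    using ys walk_edges_subset by (fastforce simp: filter_empty_conv)
  ultimately have "size (filter_mset (\<lambda>e. v \<in> e) (mset (cycle_sides (v # ys)))) = 2"
    by (simp add: cycle_sides_def flip: mset_filter)
  then show ?thesis by (simp add: c ys_def mset_cycle_sides_rotate)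
qed

text \<open>Every vertex has degree two in both cycles, so the edges of \<open>c\<close> at a vertex of \<open>c'\<close> are
  edges of \<open>c'\<close>; connectedness of \<open>c\<close> does the rest.\<close>

lemma cycle_sides_subset_imp_eq:
  assumes c: "distinct c" "length c \<ge> 2" and c': "distinct c'" "length c' \<ge> 2"
    and sub: "mset (cycle_sides c') \<subseteq># mset (cycle_sides c)"
  shows "set (cycle_sides c') = set (cycle_sides c)"
proof -
  let ?S = "set (cycle_sides c)" and ?S' = "set (cycle_sides c')"
  have S'S: "?S' \<subseteq> ?S" using set_mset_mono[OF sub] by simp
  have vert: "set c' \<subseteq> set c"
    using S'S Union_cycle_sides[OF c(2)] Union_cycle_sides[OF c'(2)] by blast
  have edge: "e \<in> ?S'" if "e \<in> ?S" "v \<in> e" "v \<in> set c'" for e v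
  proof -
    let ?f = "filter_mset (\<lambda>e. v \<in> e)"
    have "?f (mset (cycle_sides c')) \<subseteq># ?f (mset (cycle_sides c))"
      using sub by (rule multiset_filter_mono)
    moreover have "size (?f (mset (cycle_sides c'))) = size (?f (mset (cycle_sides c)))"
      using cycle_sides_degree[OF c, of v] cycle_sides_degree[OF c', of v] that vert by auto
    ultimately have "?f (mset (cycle_sides c')) = ?f (mset (cycle_sides c))"
      by (metis mset_subset_size nat_neq_iff subset_mset.le_imp_less_or_eq)
    moreover have "e \<in># ?f (mset (cycle_sides c))" using that by simp
    ultimately have "e \<in># ?f (mset (cycle_sides c'))" by simp
    then show ?thesis by simp
  qed
  have "set (c @ [hd c]) \<subseteq> set c'"
  proof (rule walk_edges_closed)
    show "set (c @ [hd c]) \<inter> set c' \<noteq> {}" using vert c' by (cases c') auto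
    fix e assume "e \<in> set (walk_edges (c @ [hd c]))" "e \<inter> set c' \<noteq> {}"
    then have "e \<in> ?S'" using edge by (auto simp: cycle_sides_def)
    then show "e \<subseteq> set c'" using Union_cycle_sides[OF c'(2)] by blast
  qed
  moreover have "e \<inter> set c \<noteq> {}" if "e \<in> ?S" for e
  proof -
    have "e \<noteq> {}" using that by (auto simp: cycle_sides_def walk_edges_def)
    then show ?thesis using that Union_cycle_sides[OF c(2)] by blast
  qed
  ultimately show ?thesis using S'S edge by (auto; blast)
qed

section \<open>Polygons and gates\<close>

context symmetric_graph
begin

abbreviation d :: "'a \<Rightarrow> 'a \<Rightarrow> nat" where
  "d \<equiv> gdist V E k"

abbreviation P :: "'a set set set" where
  "P \<equiv> polygons E k"

text \<open>The polygon that \<open>loops\<close> supplies lies inside the cycle \<open>c\<close>,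
  and a cycle contains no other cycle.\<close>

lemma simple_cycle_is_polygon:
  assumes "closed_path E c" "length c \<ge> 3"
  shows "set (cycle_sides c) \<in> P"
proof -
  obtain c' where c': "closed_path E c'" "length c' = k"
    "mset (cycle_sides c') \<subseteq># mset (cycle_sides c)"
    using loops[OF assms] by blast
  then have "set (cycle_sides c') = set (cycle_sides c)"
    using assms by (intro cycle_sides_subset_imp_eq) (auto simp: closed_path_def)
  then show ?thesis using c' unfolding polygons_def by blast
qed

lemma polygonE:
  assumes "p \<in> P"
  obtains c where "closed_path E c" "length c = k" "p = set (cycle_sides c)" "\<Union>p = set c"
proof -
  obtain c where c: "closed_path E c" "length c = k" "p = set (cycle_sides c)"
    using assms by (auto simp: polygons_def)
  with that Union_cycle_sides[of c] show ?thesis by (auto simp: closed_path_def)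
qed

lemma polygon_subset: "p \<in> P \<Longrightarrow> p \<subseteq> E"
  by (auto simp: polygons_def closed_path_def)

lemma polygon_vertices: "p \<in> P \<Longrightarrow> \<Union>p \<subseteq> V"
proof
  fix v assume "p \<in> P" "v \<in> \<Union>p"
  then obtain e where "e \<in> E" "v \<in> e" using polygon_subset by blast
  then show "v \<in> V" using edges[of e] by auto
qed

lemma card_polygon:
  assumes "p \<in> P" shows "card (\<Union>p) = k" "finite (\<Union>p)"
proof -
  obtain c where "closed_path E c" "length c = k" "\<Union>p = set c" using assms by (rule polygonE)
  then show "card (\<Union>p) = k" "finite (\<Union>p)" by (simp_all add: closed_path_def distinct_card)
qed

text \<open>A common side has an endpoint \<open>v\<close> on both polygons, and
  \<open>polygons_meet\<close> at \<open>v\<close> forbids distinct polygons to share a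
  side.\<close>

lemma polygon_eqI:
  assumes "p \<in> P" "q \<in> P" "e \<in> p" "e \<in> q"
  shows "p = q"
proof (rule ccontr)
  assume "p \<noteq> q"
  have "e \<in> E" using polygon_subset[OF assms(1)] assms(3) by (rule subsetD)
  then obtain v where "v \<in> e" using edges[of e] by auto
  then have "v \<in> \<Union>p" "v \<in> \<Union>q" using assms(3,4) by (meson UnionI)+
  then have "p \<inter> q = {}" using polygons_meet[OF assms(1,2) \<open>p \<noteq> q\<close>] by blast
  then show False using assms(3,4) by blast
qed

lemma polygon_walk:
  assumes "p \<in> P" "u \<in> \<Union>p" "w \<in> \<Union>p"
  shows "\<exists>xs. walk V p u xs w"
proof -
  obtain c where c: "closed_path E c" "length c = k" "p = set (cycle_sides c)" "\<Union>p = set c"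
    using assms(1) by (rule polygonE)
  then have ne: "c \<noteq> []" by (auto simp: closed_path_def)
  then have w: "walk V p (hd c) c (last c)"
    using c polygon_vertices[OF assms(1)] by (auto simp: walk_def cycle_sides_def walk_edges_snoc)
  \<comment> \<open>Initial segments of \<open>c\<close> reach every vertex from \<open>hd c\<close>
    without the closing side; two of them joined at \<open>hd c\<close> connect \<open>u\<close>
    with \<open>w\<close>.\<close>
  have *: "\<exists>xs. walk V p (hd c) xs z" if "z \<in> \<Union>p" for z
  proof -
    have "z \<in> set c" using that c(4) by simp
    then obtain as bs where "c = as @ z # bs" by (meson split_list)
    then show ?thesis using w walk_split(1)[of V p "hd c" as z bs "last c"] by auto
  qed
  obtain xs ys where xs: "walk V p (hd c) xs u" and ys: "walk V p (hd c) ys w"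
    using *[OF assms(2)] *[OF assms(3)] by blast
  show ?thesis using walk_join(1)[OF walk_rev[OF xs] ys] by blast
qed

text \<open>A simple path outside \<open>p\<close> that joins two vertices of \<open>p\<close> would close up, with an arc of
  \<open>p\<close>, to a simple cycle, hence to a polygon sharing a side with \<open>p\<close>.\<close>

lemma polygon_separates:
  assumes p: "p \<in> P" and uw: "u \<in> \<Union>p" "w \<in> \<Union>p" and "walk V (E - p) u xs w"
  shows "u = w"
proof (rule ccontr)
  assume "u \<noteq> w"
  obtain ys where ys: "walk V (E - p) u ys w" "distinct ys"
    using walk_distinct[OF assms(4)] by blast
  then obtain zs where zs: "ys = u # zs" by (cases ys) (auto simp: walk_def)
  have "w \<in> set zs" using ys zs \<open>u \<noteq> w\<close> by (auto simp: walk_def)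
  \<comment> \<open>\<open>v\<close> is the first vertex of \<open>p\<close> after \<open>u\<close>,
    so the path from \<open>u\<close> to \<open>v\<close> meets \<open>p\<close> only at its ends
    and the closed-up list \<open>c\<close> below is distinct.\<close>
  then obtain as v bs where v: "zs = as @ v # bs" "v \<in> \<Union>p" "\<forall>x\<in>set as. x \<notin> \<Union>p"
    using split_list_first_prop[of zs "\<lambda>x. x \<in> \<Union>p"] uw by blast
  have out: "walk V (E - p) u (u # as @ [v]) v"
    using walk_split(1)[of V "E - p" u "u # as" v bs w] ys zs v by simp
  have dist: "distinct (u # as @ [v])" using ys zs v by auto
  obtain arc where arc: "walk V p v arc u" "distinct arc"
    using polygon_walk[OF p v(2) uw(1)] walk_distinct[of V p v _ u] by blast
  have "v \<noteq> u" using dist by auto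
  have arc_in: "set arc \<subseteq> \<Union>p" and arc_ne: "set (walk_edges arc) \<noteq> {}"
    using walk_Union[OF arc(1) \<open>v \<noteq> u\<close>] arc(1) by (auto simp: walk_def)
  obtain m where m: "arc = v # m @ [u]"
  proof -
    have "arc \<noteq> []" "hd arc = v" "last arc = u" using arc by (auto simp: walk_def)
    then have "arc = v # tl arc" "tl arc \<noteq> []" "last (tl arc) = u"
      using \<open>v \<noteq> u\<close> by (cases arc; auto split: if_splits)+
    then show thesis using that by (metis append_butlast_last_id)
  qed
  define c where "c = u # as @ v # m"
  have sides: "cycle_sides c = walk_edges (u # as @ [v]) @ walk_edges arc"
    using walk_edges_append[of "u # as" v "m @ [u]"] by (simp add: c_def cycle_sides_def m)
  have "distinct c" using dist arc(2) v(3) arc_in by (auto simp: c_def m)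
  moreover have "set (cycle_sides c) \<subseteq> E"
    using sides out arc(1) polygon_subset[OF p] by (auto simp: walk_def)
  ultimately have cp: "closed_path E c" by (simp add: closed_path_def c_def)
  \<comment> \<open>If both were empty, \<open>{u, v}\<close> would be a side of \<open>p\<close>
    and at the same time an edge in \<open>E - p\<close>.\<close>
  have "as \<noteq> [] \<or> m \<noteq> []"
    using out arc(1) by (auto simp: walk_def m insert_commute)
  then have "length c \<ge> 3" by (cases as; cases m) (auto simp: c_def)
  then have q: "set (cycle_sides c) \<in> P" using simple_cycle_is_polygon cp by blast
  obtain e where "e \<in> set (walk_edges arc)" using arc_ne by (meson ex_in_conv)
  then have "set (cycle_sides c) = p"
    using polygon_eqI[OF q p, of e] sides arc(1) by (auto simp: walk_def)
  \<comment> \<open>The path outside \<open>p\<close> contributes a side of \<open>c\<close> that is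
    not in \<open>p\<close>, although \<open>c\<close> traces exactly \<open>p\<close>.\<close>
  moreover obtain e' where "e' \<in> set (walk_edges (u # as @ [v]))"
    using walk_Union(3)[OF out] \<open>v \<noteq> u\<close> by (metis ex_in_conv)
  ultimately show False using out sides by (auto simp: walk_def)
qed

text \<open>\<open>u\<close> is the vertex at which every walk from \<open>x\<close> first meets \<open>p\<close> (see \<open>gate_unique\<close>).\<close>

definition gate :: "'a set set \<Rightarrow> 'a \<Rightarrow> 'a \<Rightarrow> bool" where
  "gate p x u \<longleftrightarrow> u \<in> \<Union>p \<and> (\<exists>xs. walk V (E - p) x xs u)"

lemma gate_unique:
  assumes "p \<in> P" "gate p x u" "gate p x w"
  shows "u = w"
proof -
  obtain xs ys where xs: "walk V (E - p) x xs u" and ys: "walk V (E - p) x ys w"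
    using assms(2,3) unfolding gate_def by blast
  show ?thesis
    using assms(2,3) polygon_separates[OF assms(1) _ _ walk_join(1)[OF walk_rev[OF xs] ys]]
    unfolding gate_def by blast
qed

text \<open>Cut the walk at its first vertex \<open>u\<close> on \<open>p\<close>: a side of
  \<open>p\<close> before that point would have both ends equal to \<open>u\<close>. The edge set
  \<open>F\<close> is general because the walk is taken in \<open>E\<close> as well as in
  \<open>E\<close> without another polygon.\<close>

lemma walk_gate_prefix:
  assumes "walk V F x xs y" "F \<subseteq> E" "set xs \<inter> \<Union>p \<noteq> {}"
  shows "\<exists>ys u zs. xs = ys @ u # zs \<and> u \<in> \<Union>p \<and> walk V (F - p) x (ys @ [u]) u"
proof -
  obtain ys u zs where xs: "xs = ys @ u # zs" "u \<in> \<Union>p" "\<forall>y\<in>set ys. y \<notin> \<Union>p"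
    using split_list_first_prop[of xs "\<lambda>x. x \<in> \<Union>p"] assms(3) by blast
  have w: "walk V F x (ys @ [u]) u" using assms(1) xs walk_split by metis
  have "e \<notin> p" if "e \<in> set (walk_edges (ys @ [u]))" for e
  proof
    assume "e \<in> p"
    have "e \<subseteq> set (ys @ [u])" "e \<subseteq> \<Union>p"
      using that walk_edges_subset \<open>e \<in> p\<close> by blast+
    then have "e \<subseteq> {u}" using xs(3) by auto
    moreover have "e \<in> E" using that w assms(2) by (auto simp: walk_def)
    ultimately show False using edges[of e] by auto
  qed
  then have "walk V (F - p) x (ys @ [u]) u" using w by (auto simp: walk_def)
  then show ?thesis using xs by blast
qed

lemma gate_exists:
  assumes "p \<in> P" "x \<in> V" "y \<in> \<Union>p"
  shows "\<exists>u. gate p x u"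
proof -
  obtain xs where xs: "walk V E x xs y"
    using connected[OF assms(2)] polygon_vertices[OF assms(1)] assms(3) by blast
  then have "y \<in> set xs" by (auto simp: walk_def)
  then have "set xs \<inter> \<Union>p \<noteq> {}" using assms(3) by blast
  from walk_gate_prefix[OF xs order_refl this] show ?thesis by (auto simp: gate_def)
qed

section \<open>Distances\<close>

definition crossed :: "'a list \<Rightarrow> 'a set set set" where
  "crossed xs = {p \<in> P. p \<inter> set (walk_edges xs) \<noteq> {}}"

text \<open>Each edge of the walk lies in at most one polygon. Finiteness matters because
  \<open>card\<close> is 0 on infinite sets.\<close>

lemma finite_crossed: "finite (crossed xs)"
proof -
  have "finite {p \<in> P. e \<in> p}" for e
  proof (cases "\<exists>p\<in>P. e \<in> p")
    case True
    then obtain p where "p \<in> P" "e \<in> p" by blast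
    then have "{p \<in> P. e \<in> p} \<subseteq> {p}" using polygon_eqI by blast
    then show ?thesis by (rule finite_subset) simp
  next
    case False
    then have "{p \<in> P. e \<in> p} = {}" by blast
    then show ?thesis by (simp only: finite.emptyI)
  qed
  then have "finite (\<Union>e\<in>set (walk_edges xs). {p \<in> P. e \<in> p})" by blast
  then show ?thesis by (rule rev_finite_subset) (auto simp: crossed_def)
qed

lemma gdist_le: "walk V E x xs y \<Longrightarrow> d x y \<le> card (crossed xs)"
  unfolding gdist_def crossed_def by (rule Least_le) blast

lemma geodesic_walk:
  assumes "x \<in> V" "y \<in> V"
  shows "\<exists>xs. walk V E x xs y \<and> card (crossed xs) = d x y"
proof -
  have "\<exists>n xs. walk V E x xs y \<and> n = card (crossed xs)" using connected[OF assms] by blast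
  from LeastI_ex[OF this] show ?thesis unfolding gdist_def crossed_def by metis
qed

lemma gdist_le_subset:
  assumes "walk V E x xs y" "crossed xs \<subseteq> A" "finite A"
  shows "d x y \<le> card A"
  using gdist_le[OF assms(1)] card_mono[OF assms(3,2)] by simp

lemma gdist_commute:
  assumes "x \<in> V" "y \<in> V" shows "d x y = d y x"
proof -
  have le: "d x y \<le> d y x" if "x \<in> V" "y \<in> V" for x y
  proof -
    obtain xs where "walk V E y xs x" "card (crossed xs) = d y x"
      using geodesic_walk \<open>x \<in> V\<close> \<open>y \<in> V\<close> by blast
    then show ?thesis
      using gdist_le[OF walk_rev] by (fastforce simp: crossed_def set_walk_edges_rev)
  qed
  show ?thesis using le assms by (simp add: order_antisym)
qed

lemma gdist_triangle:
  assumes "x \<in> V" "y \<in> V" "z \<in> V" shows "d x z \<le> d x y + d y z"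
proof -
  obtain xs ys where w: "walk V E x xs y" "card (crossed xs) = d x y"
    "walk V E y ys z" "card (crossed ys) = d y z"
    using geodesic_walk assms by meson
  have "crossed (xs @ tl ys) \<subseteq> crossed xs \<union> crossed ys"
    using walk_join(2)[OF w(1,3)] by (auto simp: crossed_def)
  then have "d x z \<le> card (crossed xs \<union> crossed ys)"
    using gdist_le_subset[OF walk_join(1)[OF w(1,3)]] finite_crossed by blast
  also have "\<dots> \<le> d x y + d y z" using card_Un_le w by metis
  finally show ?thesis .
qed

lemma gdist_self: "x \<in> V \<Longrightarrow> d x x = 0"
  using gdist_le[OF walk_refl] by (fastforce simp: crossed_def)

text \<open>By \<open>edges_covered\<close> every edge crosses some polygon, so a walk that crosses
  none is a single vertex.\<close>

lemma gdist_eq_0_iff: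
  assumes "x \<in> V" "y \<in> V" shows "d x y = 0 \<longleftrightarrow> x = y"
proof
  assume "d x y = 0"
  then obtain xs where w: "walk V E x xs y" "card (crossed xs) = 0"
    using geodesic_walk assms by metis
  have none: "crossed xs = {}" using w(2) finite_crossed by simp
  have "e \<notin> set (walk_edges xs)" for e
  proof
    assume e: "e \<in> set (walk_edges xs)"
    then have "e \<in> E" using w(1) by (auto simp: walk_def)
    then obtain p where "p \<in> P" "e \<in> p" using edges_covered by meson
    then have "p \<in> crossed xs" using e by (auto simp: crossed_def)
    then show False using none by simp
  qed
  then have "set (walk_edges xs) = {}" by (metis ex_in_conv)
  then show "x = y" using walk_Union(3)[OF w(1)] by metis
qed (use gdist_self assms in simp)

lemma gdist_polygon_le:
  assumes "p \<in> P" "u \<in> \<Union>p" "w \<in> \<Union>p" shows "d u w \<le> 1"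
proof -
  obtain xs where xs: "walk V p u xs w" using polygon_walk assms by blast
  have "crossed xs \<subseteq> {p}"
    using xs polygon_eqI[OF _ assms(1)] by (fastforce simp: crossed_def walk_def)
  then show ?thesis
    using gdist_le_subset[OF walk_mono[OF xs polygon_subset[OF assms(1)]], of "{p}"] by simp
qed

text \<open>When a walk crosses only \<open>p\<close>, all its edges are sides of \<open>p\<close>,
  because each edge lies in some crossed polygon.\<close>

lemma gdist_eq_1_iff:
  assumes "x \<in> V" "y \<in> V"
  shows "d x y = 1 \<longleftrightarrow> x \<noteq> y \<and> (\<exists>p\<in>P. x \<in> \<Union>p \<and> y \<in> \<Union>p)"
proof
  assume 1: "d x y = 1"
  then have ne: "x \<noteq> y" using gdist_self assms by auto
  obtain xs where xs: "walk V E x xs y" "card (crossed xs) = 1"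
    using geodesic_walk[OF assms] 1 by auto
  then obtain p where p: "crossed xs = {p}" by (auto simp: card_1_singleton_iff)
  then have "set (walk_edges xs) \<subseteq> p"
    using edges_covered xs(1) by (fastforce simp: crossed_def walk_def)
  then have "set xs \<subseteq> \<Union>p" using walk_Union(1)[OF xs(1) ne] by blast
  moreover have "p \<in> P" using p by (auto simp: crossed_def)
  moreover have "x \<in> set xs" "y \<in> set xs" using xs(1) by (auto simp: walk_def)
  ultimately show "x \<noteq> y \<and> (\<exists>p\<in>P. x \<in> \<Union>p \<and> y \<in> \<Union>p)" using ne by (meson subsetD)
next
  assume R: "x \<noteq> y \<and> (\<exists>p\<in>P. x \<in> \<Union>p \<and> y \<in> \<Union>p)"
  then have "d x y \<le> 1" using gdist_polygon_le by meson
  moreover have "d x y \<noteq> 0" using R gdist_eq_0_iff[OF assms] by simp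
  ultimately show "d x y = 1" by linarith
qed

text \<open>A geodesic from \<open>x\<close> to \<open>w\<close> passes the gate \<open>u\<close>
  before it uses \<open>p\<close>, and it must cross \<open>p\<close>, since otherwise
  \<open>w\<close> would be a second gate. Its part up to \<open>u\<close> therefore crosses at
  least one polygon fewer.\<close>

lemma gdist_gate:
  assumes p: "p \<in> P" and u: "gate p x u" and w: "w \<in> \<Union>p" "w \<noteq> u"
  shows "d x w = Suc (d x u)"
proof (rule order_antisym)
  have V: "x \<in> V" "u \<in> V" "w \<in> V"
    using u w polygon_vertices[OF p] by (auto simp: gate_def walk_def)
  have "d u w \<le> 1" using gdist_polygon_le[OF p _ w(1)] u by (auto simp: gate_def)
  then show "d x w \<le> Suc (d x u)" using gdist_triangle[OF V] by simp
  obtain xs where xs: "walk V E x xs w" "card (crossed xs) = d x w"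
    using geodesic_walk V by blast
  have "w \<in> set xs" using xs(1) by (auto simp: walk_def)
  then have "set xs \<inter> \<Union>p \<noteq> {}" using w(1) by blast
  from walk_gate_prefix[OF xs(1) order_refl this] obtain ys u' zs
    where pre: "xs = ys @ u' # zs" "u' \<in> \<Union>p" "walk V (E - p) x (ys @ [u']) u'" by blast
  have "u' = u" using gate_unique[OF p _ u] pre by (auto simp: gate_def)
  have "p \<in> crossed xs"
  proof (rule ccontr)
    assume "p \<notin> crossed xs"
    then have "walk V (E - p) x xs w" using p xs(1) by (auto simp: crossed_def walk_def)
    then have "gate p x w" using w by (auto simp: gate_def)
    then show False using gate_unique[OF p _ u] w by blast
  qed
  moreover have "crossed (ys @ [u]) \<subseteq> crossed xs"
    using walk_edges_append[of ys u' zs] pre \<open>u' = u\<close> by (auto simp: crossed_def)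
  ultimately have "insert p (crossed (ys @ [u])) \<subseteq> crossed xs" by blast
  then have "card (insert p (crossed (ys @ [u]))) \<le> d x w"
    using card_mono[OF finite_crossed] xs(2) by metis
  moreover have "p \<notin> crossed (ys @ [u])"
    using pre \<open>u' = u\<close> by (auto simp: crossed_def walk_def)
  moreover have "d x u \<le> card (crossed (ys @ [u]))"
    using gdist_le[OF walk_mono[OF pre(3)]] \<open>u' = u\<close> by auto
  ultimately show "Suc (d x u) \<le> d x w" by (simp add: finite_crossed)
qed

section \<open>The polygons at a vertex as seen from another vertex\<close>

lemma ungated_polygon_exists:
  assumes "x \<in> V" "y \<in> V" "x \<noteq> y"
  shows "\<exists>p\<in>P. y \<in> \<Union>p \<and> \<not> gate p x y"
proof -
  obtain xs where xs: "walk V E x xs y" "card (crossed xs) = d x y"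
    using geodesic_walk assms by blast
  define ys where "ys = butlast xs"
  have ys: "xs = ys @ [y]" "ys \<noteq> []"
    using walk_Union(2)[OF xs(1) assms(3)] xs(1)
    by (auto simp: walk_def ys_def simp flip: length_greater_0_conv)
  define z where "z = last ys"
  \<comment> \<open>The last edge \<open>{z, y}\<close> of the geodesic lies in some polygon
    \<open>p\<close>. Were \<open>y\<close> the gate of \<open>p\<close>, then \<open>z\<close>
    would be farther from \<open>x\<close> than \<open>y\<close>, but the geodesic passes
    \<open>z\<close> first.\<close>
  have w: "walk V E x ys z" and e: "{z, y} \<in> E"
    using xs(1) ys by (auto simp: walk_def z_def walk_edges_snoc)
  have "crossed ys \<subseteq> crossed xs" using ys by (auto simp: crossed_def walk_edges_snoc)
  then have le: "d x z \<le> d x y" using gdist_le_subset[OF w] finite_crossed xs(2) by metis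
  obtain p where p: "p \<in> P" "{z, y} \<in> p" using edges_covered[OF e] by blast
  moreover have "z \<noteq> y" using edges[OF e] by (auto simp: doubleton_eq_iff)
  ultimately have "\<not> gate p x y" using gdist_gate[OF p(1), of x y z] le by force
  then show ?thesis using p by blast
qed

text \<open>Follow a walk from \<open>x\<close> to the gate of \<open>p\<close>. If it misses
  \<open>q\<close>, continuing along \<open>p\<close> reaches \<open>y\<close> without sides of
  \<open>q\<close>; if it meets \<open>q\<close>, continuing along \<open>q\<close> from the first
  meeting point reaches \<open>y\<close> without sides of \<open>p\<close>. Either way
  \<open>y\<close> is a gate.\<close>

lemma ungated_polygon_unique:
  assumes p: "p \<in> P" "y \<in> \<Union>p" "\<not> gate p x y"
    and q: "q \<in> P" "y \<in> \<Union>q" "\<not> gate q x y" and "x \<in> V"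
  shows "p = q"
proof (rule ccontr)
  assume "p \<noteq> q"
  then have disj: "p \<inter> q = {}" using polygons_meet[OF p(1) q(1) _ p(2) q(2)] by simp
  obtain u xs where u: "u \<in> \<Union>p" and xs: "walk V (E - p) x xs u"
    using gate_exists[OF p(1) \<open>x \<in> V\<close> p(2)] by (auto simp: gate_def)
  show False
  proof (cases "set xs \<inter> \<Union>q = {}")
    case True
    have "e \<notin> q" if "e \<in> set (walk_edges xs)" for e
    proof
      assume "e \<in> q"
      then have "e \<subseteq> set xs \<inter> \<Union>q" using walk_edges_subset[OF that] by blast
      then have "e = {}" using True by simp
      then show False using edges[of e] polygon_subset[OF q(1)] \<open>e \<in> q\<close> by auto
    qed
    then have 1: "walk V (E - q) x xs u" using xs by (auto simp: walk_def)
    obtain ys where "walk V p u ys y" using polygon_walk[OF p(1) u p(2)] by blast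
    then have "walk V (E - q) u ys y"
      by (rule walk_mono) (use disj polygon_subset[OF p(1)] in blast)
    then have "gate q x y" using walk_join(1)[OF 1] q(2) unfolding gate_def by blast
    then show False using q by blast
  next
    case False
    from walk_gate_prefix[OF xs _ this] obtain ys w
      where w: "w \<in> \<Union>q" "walk V (E - p - q) x (ys @ [w]) w" by blast
    have 1: "walk V (E - p) x (ys @ [w]) w" using w(2) by (rule walk_mono) blast
    obtain zs where "walk V q w zs y" using polygon_walk[OF q(1) w(1) q(2)] by blast
    then have "walk V (E - p) w zs y"
      by (rule walk_mono) (use disj polygon_subset[OF q(1)] in blast)
    then have "gate p x y" using walk_join(1)[OF 1] p(2) unfolding gate_def by blast
    then show False using p by blast
  qed
qed

end

section \<open>Distance regularity\<close>

lemma sum_by_value: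
  fixes h g :: "_ \<Rightarrow> nat"
  assumes "finite A" "\<And>c. c > N \<Longrightarrow> h c = 0"
  shows "(\<Sum>x\<in>A. h (g x)) = (\<Sum>c\<le>N. card {x \<in> A. g x = c} * h c)"
proof -
  have "(\<Sum>x\<in>A. h (g x)) = (\<Sum>x\<in>{x \<in> A. g x \<le> N}. h (g x))"
    using assms by (intro sum.mono_neutral_right) (auto simp: not_le)
  also have "\<dots> = (\<Sum>c\<le>N. \<Sum>x\<in>{x \<in> {x \<in> A. g x \<le> N}. g x = c}. h (g x))"
    by (rule sum.group[symmetric]) (use assms in auto)
  also have "\<dots> = (\<Sum>c\<le>N. card {x \<in> A. g x = c} * h c)"
  proof (rule sum.cong)
    fix c assume "c \<in> {..N}"
    then have "{x \<in> {x \<in> A. g x \<le> N}. g x = c} = {x \<in> A. g x = c}" by auto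
    then show "(\<Sum>x\<in>{x \<in> {x \<in> A. g x \<le> N}. g x = c}. h (g x)) = card {x \<in> A. g x = c} * h c"
      by simp
  qed simp
  finally show ?thesis .
qed

locale nondegenerate_symmetric_graph = symmetric_graph +
  assumes k_ge: "k \<ge> 2" and r_ge: "r \<ge> 2"
begin

definition sphere :: "'a \<Rightarrow> nat \<Rightarrow> 'a set" where
  "sphere x n = {z \<in> V. d x z = n}"

lemma sphere_subset: "sphere x n \<subseteq> V"
  by (auto simp: sphere_def)

definition polygons_at :: "'a \<Rightarrow> 'a set set set" where
  "polygons_at y = {p \<in> P. y \<in> \<Union>p}"

lemma polygons_atD: "p \<in> polygons_at y \<Longrightarrow> p \<in> P \<and> y \<in> \<Union>p"
  by (simp add: polygons_at_def)

lemma card_polygons_at: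
  assumes "y \<in> V" shows "card (polygons_at y) = r" "finite (polygons_at y)"
proof -
  show "card (polygons_at y) = r" using order[OF assms] by (simp add: polygons_at_def)
  \<comment> \<open>\<open>card\<close> vanishes on infinite sets, while \<open>r\<close> is
    positive.\<close>
  then show "finite (polygons_at y)" using r_ge card.infinite by fastforce
qed

section \<open>Neighbours and finiteness of spheres\<close>

lemma neighbours_eq:
  assumes "y \<in> V"
  shows "sphere y 1 = (\<Union>p\<in>polygons_at y. \<Union>p - {y})"
proof (rule set_eqI)
  fix z
  show "z \<in> sphere y 1 \<longleftrightarrow> z \<in> (\<Union>p\<in>polygons_at y. \<Union>p - {y})"
  proof
    assume z: "z \<in> sphere y 1"
    then have "z \<in> V" "d y z = 1" by (auto simp: sphere_def)
    then obtain p where "p \<in> P" "y \<in> \<Union>p" "z \<in> \<Union>p" "y \<noteq> z"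
      using gdist_eq_1_iff[OF assms] by metis
    then show "z \<in> (\<Union>p\<in>polygons_at y. \<Union>p - {y})"
      by (intro UN_I[of p]) (simp_all add: polygons_at_def)
  next
    assume "z \<in> (\<Union>p\<in>polygons_at y. \<Union>p - {y})"
    then obtain p where p: "p \<in> P" "y \<in> \<Union>p" "z \<in> \<Union>p" "y \<noteq> z"
      by (auto simp: polygons_at_def)
    then have "z \<in> V" using polygon_vertices by (meson subsetD)
    then show "z \<in> sphere y 1" using gdist_eq_1_iff[OF assms] p by (simp add: sphere_def) blast
  qed
qed

lemma finite_neighbours:
  assumes "y \<in> V" shows "finite (sphere y 1)"
  unfolding neighbours_eq[OF assms]
proof (rule finite_UN_I)
  show "finite (polygons_at y)" by (rule card_polygons_at[OF assms])
  fix p assume "p \<in> polygons_at y"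
  then have "finite (\<Union>p)" using polygons_atD card_polygon(2) by blast
  then show "finite (\<Union>p - {y})" by (rule finite_Diff)
qed

text \<open>A vertex \<open>z\<close> at distance \<open>n + 1\<close> lies on a polygon whose gate
  from \<open>x\<close> is a neighbour of \<open>z\<close> at distance \<open>n\<close>, so finitely
  many finite neighbourhoods cover the next sphere.\<close>

lemma finite_sphere:
  assumes "x \<in> V" shows "finite (sphere x n)"
proof (induction n)
  case 0
  have "sphere x 0 \<subseteq> {x}" using gdist_eq_0_iff[OF assms] by (auto simp: sphere_def)
  then show ?case by (rule finite_subset) simp
next
  case (Suc n)
  have "sphere x (Suc n) \<subseteq> (\<Union>y\<in>sphere x n. sphere y 1)"
  proof
    fix z assume "z \<in> sphere x (Suc n)"
    then have z: "z \<in> V" "d x z = Suc n" by (auto simp: sphere_def)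
    then have "x \<noteq> z" using gdist_self by auto
    then obtain p where p: "p \<in> P" "z \<in> \<Union>p" "\<not> gate p x z"
      using ungated_polygon_exists[OF assms z(1)] by meson
    obtain u where u: "gate p x u" using gate_exists[OF p(1) assms p(2)] by meson
    have "z \<noteq> u" using p u by auto
    have up: "u \<in> \<Union>p" using u by (simp add: gate_def)
    then have "u \<in> V" using polygon_vertices[OF p(1)] by (meson subsetD)
    have "d x u = n" using gdist_gate[OF p(1) u p(2) \<open>z \<noteq> u\<close>] z by simp
    moreover have "d u z = 1"
      using gdist_eq_1_iff[OF \<open>u \<in> V\<close> z(1)] p up \<open>z \<noteq> u\<close> by metis
    ultimately show "z \<in> (\<Union>y\<in>sphere x n. sphere y 1)"
      using z \<open>u \<in> V\<close> by (auto simp: sphere_def)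
  qed
  moreover have "finite (\<Union>y\<in>sphere x n. sphere y 1)"
    using Suc finite_neighbours sphere_subset by (meson finite_UN_I subsetD)
  ultimately show ?case by (rule finite_subset)
qed

text \<open>Intersection numbers: how many neighbours at distance \<open>j\<close> from
  \<open>x\<close> a vertex at distance \<open>i\<close> from \<open>x\<close> has. For
  \<open>i > 0\<close>, going out uses the \<open>r - 1\<close> gated polygons; the remaining one
  holds the gate, one step nearer, and \<open>k - 2\<close> vertices at equal distance. For
  \<open>i = 0\<close> all \<open>r\<close> polygons lead outwards.\<close>

definition nbr_count :: "nat \<Rightarrow> nat \<Rightarrow> nat" where
  "nbr_count i j =
     (if i = 0 then (if j = 1 then r * (k - 1) else 0)
      else if j = Suc i then (r - 1) * (k - 1)
      else if j = i then k - 2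
      else if Suc j = i then 1 else 0)"

text \<open>Distinct polygons at \<open>y\<close> meet only in \<open>y\<close>, so the count splits
  into one contribution per polygon.\<close>

lemma card_neighbours_at_distance:
  assumes x: "x \<in> V" and y: "y \<in> V"
  shows "card {z \<in> sphere y 1. d x z = j} = nbr_count (d x y) j"
proof -
  let ?A = "\<lambda>p. {z \<in> \<Union>p - {y}. d x z = j}"
  have fin: "finite (?A p)" if "p \<in> polygons_at y" for p
    by (rule finite_subset[OF _ card_polygon(2)[of p]]) (use polygons_atD[OF that] in auto)
  have gated: "card (?A p) = (if j = Suc (d x y) then k - 1 else 0)"
    if "p \<in> polygons_at y" "gate p x y" for p
  proof -
    have p: "p \<in> P" "y \<in> \<Union>p" using that(1) polygons_atD by auto
    have "?A p = (if j = Suc (d x y) then \<Union>p - {y} else {})"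
      using gdist_gate[OF p(1) that(2)] by auto
    then show ?thesis using card_polygon[OF p(1)] p(2) by (simp add: card_Diff_singleton)
  qed
  have disj: "?A p \<inter> ?A q = {}" if "p \<in> polygons_at y" "q \<in> polygons_at y" "p \<noteq> q" for p q
  proof -
    have "\<Union>p \<inter> \<Union>q = {y}"
      using polygons_meet[of p q y] that polygons_atD by metis
    then show ?thesis by blast
  qed
  have "{z \<in> sphere y 1. d x z = j} = (\<Union>p\<in>polygons_at y. ?A p)"
    unfolding neighbours_eq[OF y] by auto
  then have sum: "card {z \<in> sphere y 1. d x z = j} = (\<Sum>p\<in>polygons_at y. card (?A p))"
    using disj fin card_polygons_at[OF y] by (simp add: card_UN_disjoint del: Diff_iff)
  show ?thesis
  proof (cases "x = y")
    case True
    \<comment> \<open>Seen from \<open>x = y\<close>, every polygon at \<open>y\<close> has gate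
      \<open>y\<close>, by the one-vertex walk.\<close>
    have "gate p x y" if "p \<in> polygons_at y" for p
      using that walk_refl[OF y] polygons_atD True unfolding gate_def by metis
    then have "card {z \<in> sphere y 1. d x z = j}
        = (\<Sum>p\<in>polygons_at y. if j = Suc (d x y) then k - 1 else 0)"
      unfolding sum using gated by (intro sum.cong) auto
    then show ?thesis
      using True gdist_self[OF y] card_polygons_at[OF y] by (simp add: nbr_count_def)
  next
    case False
    then have pos: "d x y \<noteq> 0" using gdist_eq_0_iff[OF x y] by simp
    obtain p where p: "p \<in> P" "y \<in> \<Union>p" "\<not> gate p x y"
      using ungated_polygon_exists[OF x y False] by meson
    then have pin: "p \<in> polygons_at y" by (simp add: polygons_at_def)
    obtain u where u: "gate p x u" using gate_exists[OF p(1) x p(2)] by meson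
    have "y \<noteq> u" using p u by auto
    have up: "u \<in> \<Union>p" using u by (simp add: gate_def)
    have dy: "d x y = Suc (d x u)" using gdist_gate[OF p(1) u p(2) \<open>y \<noteq> u\<close>] .
    have "?A p = (if j = d x u then {u} else if j = d x y then \<Union>p - {y, u} else {})"
    proof (rule set_eqI)
      fix z
      show "z \<in> ?A p \<longleftrightarrow> z \<in> (if j = d x u then {u} else if j = d x y then \<Union>p - {y, u} else {})"
      proof (cases "z \<in> \<Union>p \<and> z \<noteq> u")
        case True
        then have "d x z = Suc (d x u)" using gdist_gate[OF p(1) u] by blast
        then show ?thesis using True dy by (simp del: Union_iff)
      next
        case False
        then show ?thesis using up \<open>y \<noteq> u\<close> by (auto simp del: Union_iff)
      qed
    qed
    moreover have "card (\<Union>p - {y, u}) = k - 2"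
      using card_polygon[OF p(1)] p(2) up \<open>y \<noteq> u\<close> by (subst card_Diff_subset) auto
    ultimately have Ap: "card (?A p) = (if Suc j = d x y then 1 else if j = d x y then k - 2 else 0)"
      using dy by simp
    have "gate q x y" if "q \<in> polygons_at y - {p}" for q
      using ungated_polygon_unique[OF p _ _ _ x, of q] that polygons_atD[of q y] by auto
    then have "(\<Sum>q\<in>polygons_at y - {p}. card (?A q))
        = (\<Sum>q\<in>polygons_at y - {p}. if j = Suc (d x y) then k - 1 else 0)"
      using gated by (intro sum.cong) auto
    also have "\<dots> = (if j = Suc (d x y) then (r - 1) * (k - 1) else 0)"
      using card_polygons_at[OF y] pin by simp
    finally show ?thesis
      unfolding sum using Ap pos
      by (subst sum.remove[OF card_polygons_at(2)[OF y] pin]) (auto simp: nbr_count_def)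
  qed
qed

lemma nbr_count_eq_0: "i > Suc j \<Longrightarrow> nbr_count i j = 0"
  by (auto simp: nbr_count_def)

lemma nbr_count_down: "nbr_count (Suc j) j = 1"
  by (simp add: nbr_count_def)

text \<open>Count the pairs of neighbours \<open>(u, z)\<close> with \<open>d x u = a\<close> and \<open>d y z = b\<close> in two ways.\<close>

lemma sphere_inter_recursion:
  assumes x: "x \<in> V" and y: "y \<in> V"
  shows "card (sphere x a \<inter> sphere y (Suc b)) + (\<Sum>c\<le>b. card (sphere x a \<inter> sphere y c) * nbr_count c b)
       = (\<Sum>c\<le>Suc a. card (sphere x c \<inter> sphere y b) * nbr_count c a)"
proof -
  let ?N = "\<lambda>u z. d u z = 1"
  have nbr: "card {z \<in> sphere w b. ?N u z} = nbr_count (d w u) b" if "w \<in> V" "u \<in> V" for w u b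
  proof -
    have "{z \<in> sphere w b. ?N u z} = {z \<in> sphere u 1. d w z = b}" by (auto simp: sphere_def)
    then show ?thesis using card_neighbours_at_distance that by simp
  qed
  have "(\<Sum>u\<in>sphere x a. card {z \<in> sphere y b. ?N u z})
      = (\<Sum>z\<in>sphere y b. card {u \<in> sphere x a. ?N u z})"
    by (rule sum_multicount_gen) (simp_all add: finite_sphere x y)
  also have "\<dots> = (\<Sum>z\<in>sphere y b. nbr_count (d x z) a)"
  proof (rule sum.cong)
    fix z assume "z \<in> sphere y b"
    then have z: "z \<in> V" by (simp add: sphere_def)
    have "{u \<in> sphere x a. ?N u z} = {u \<in> sphere x a. ?N z u}"
      using gdist_commute z by (auto simp: sphere_def)
    then show "card {u \<in> sphere x a. ?N u z} = nbr_count (d x z) a" using nbr[OF x z] by simp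
  qed simp
  also have "\<dots> = (\<Sum>c\<le>Suc a. card {z \<in> sphere y b. d x z = c} * nbr_count c a)"
    using finite_sphere[OF y] nbr_count_eq_0 by (intro sum_by_value) auto
  also have "\<dots> = (\<Sum>c\<le>Suc a. card (sphere x c \<inter> sphere y b) * nbr_count c a)"
    by (intro sum.cong refl arg_cong2[where f="(*)"] arg_cong[where f=card]) (auto simp: sphere_def)
  finally have R: "(\<Sum>u\<in>sphere x a. card {z \<in> sphere y b. ?N u z}) = \<dots>" .
  have "(\<Sum>u\<in>sphere x a. card {z \<in> sphere y b. ?N u z}) = (\<Sum>u\<in>sphere x a. nbr_count (d y u) b)"
    using nbr[OF y] by (intro sum.cong) (auto simp: sphere_def)
  also have "\<dots> = (\<Sum>c\<le>Suc b. card {u \<in> sphere x a. d y u = c} * nbr_count c b)"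
    using finite_sphere[OF x] nbr_count_eq_0 by (intro sum_by_value) auto
  also have "\<dots> = (\<Sum>c\<le>Suc b. card (sphere x a \<inter> sphere y c) * nbr_count c b)"
    by (intro sum.cong refl arg_cong2[where f="(*)"] arg_cong[where f=card]) (auto simp: sphere_def)
  \<comment> \<open>The top term \<open>c = Suc b\<close> has coefficient
    \<open>nbr_count (Suc b) b = 1\<close>; splitting it off lets the recursion be solved for
    it.\<close>
  finally show ?thesis using R by (simp add: nbr_count_down)
qed

text \<open>Induction on \<open>b\<close>: the recursion expresses the count for
  \<open>Suc c\<close> through counts with second radius at most \<open>c\<close>, with coefficients
  common to both pairs. The first radius may rise to \<open>Suc a\<close>, hence \<open>a\<close> is
  arbitrary. The distance of the centres enters at \<open>b = 0\<close>.\<close>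

lemma card_sphere_inter:
  assumes "x \<in> V" "y \<in> V" "x' \<in> V" "y' \<in> V" "d x y = d x' y'"
  shows "card (sphere x a \<inter> sphere y b) = card (sphere x' a \<inter> sphere y' b)"
proof (induction b arbitrary: a rule: less_induct)
  case (less b)
  show ?case
  proof (cases b)
    case 0
    have *: "card (sphere x a \<inter> sphere y 0) = (if d x y = a then 1 else 0)"
      if "x \<in> V" "y \<in> V" for x y
    proof -
      have "sphere x a \<inter> sphere y 0 = (if d x y = a then {y} else {})"
        using that gdist_eq_0_iff[OF that(2)] by (auto simp: sphere_def)
      then show ?thesis by simp
    qed
    show ?thesis using * assms 0 by simp
  next
    case (Suc c)
    have "(\<Sum>e\<le>c. card (sphere x a \<inter> sphere y e) * nbr_count e c)
        = (\<Sum>e\<le>c. card (sphere x' a \<inter> sphere y' e) * nbr_count e c)"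
      using less Suc by (intro sum.cong) auto
    moreover have "(\<Sum>e\<le>Suc a. card (sphere x e \<inter> sphere y c) * nbr_count e a)
        = (\<Sum>e\<le>Suc a. card (sphere x' e \<inter> sphere y' c) * nbr_count e a)"
      using less Suc by (intro sum.cong) auto
    ultimately show ?thesis
      using sphere_inter_recursion[OF assms(1,2), of a c] sphere_inter_recursion[OF assms(3,4), of a c] Suc
      by simp
  qed
qed

end

section \<open>Horocycles and the boundary measure\<close>

context nondegenerate_symmetric_graph
begin

abbreviation Q :: nat where
  "Q \<equiv> branching k r"

lemma Q_pos: "Q > 0"
  using k_ge r_ge by (simp add: branching_def)

lemma ray_in: "\<omega> \<in> rays V E k v0 \<Longrightarrow> \<omega> i \<in> V"
  by (simp add: rays_def)

lemma gdist_ray: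
  assumes "\<omega> \<in> rays V E k v0" shows "d v0 (\<omega> m) = m"
proof -
  have "\<omega> 0 = v0" "int (d (\<omega> 0) (\<omega> m)) = \<bar>int 0 - int m\<bar>"
    using assms unfolding rays_def by blast+
  then show ?thesis by simp
qed

lemma busemann_ray:
  assumes "\<omega> \<in> rays V E k v0"
  shows "busemann V E k v0 x \<omega> = int (Suc (d x v0)) - int (d x (\<omega> (Suc (d x v0))))"
  unfolding busemann_def Let_def gdist_ray[OF assms] ..

text \<open>Two triangle inequalities. The bound leaves finitely many values at each
  \<open>x\<close>, which makes the integrand bounded.\<close>

lemma busemann_bound:
  assumes v0: "v0 \<in> V" and x: "x \<in> V" and "\<omega> \<in> rays V E k v0"
  shows "\<bar>busemann V E k v0 x \<omega>\<bar> \<le> int (d x v0)"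
proof -
  let ?y = "\<omega> (Suc (d x v0))"
  have y: "?y \<in> V" "d v0 ?y = Suc (d x v0)" using assms(3) ray_in gdist_ray by auto
  have "d v0 ?y \<le> d x v0 + d x ?y"
    using gdist_triangle[OF v0 x y(1)] gdist_commute[OF x v0] by simp
  moreover have "d x ?y \<le> d x v0 + d v0 ?y" using gdist_triangle[OF x v0 y(1)] .
  ultimately show ?thesis using y(2) by (simp add: busemann_ray[OF assms(3)])
qed

text \<open>On the sphere of radius \<open>n\<close> the Busemann function uses the ray only through
  \<open>\<omega> (Suc n)\<close>, so its level sets there are intersections of two spheres whose
  centres are \<open>n + 1\<close> apart for every ray.\<close>

lemma card_sphere_horocycle:
  assumes v0: "v0 \<in> V" and \<omega>: "\<omega> \<in> rays V E k v0" and \<omega>': "\<omega>' \<in> rays V E k v0"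
  shows "card {x \<in> sphere v0 n. busemann V E k v0 x \<omega> = h}
       = card {x \<in> sphere v0 n. busemann V E k v0 x \<omega>' = h}"
proof -
  \<comment> \<open>The case \<open>h > n + 1\<close> is separated because \<open>nat\<close> would
    turn the negative radius into 0.\<close>
  have *: "{x \<in> sphere v0 n. busemann V E k v0 x \<omega> = h}
     = (if h \<le> int (Suc n) then sphere v0 n \<inter> sphere (\<omega> (Suc n)) (nat (int (Suc n) - h)) else {})"
    if \<omega>: "\<omega> \<in> rays V E k v0" for \<omega>
  proof -
    have "busemann V E k v0 x \<omega> = int (Suc n) - int (d (\<omega> (Suc n)) x)" if "x \<in> sphere v0 n" for x
      using that gdist_commute[OF v0, of x] gdist_commute[OF ray_in[OF \<omega>], of x]
      by (simp add: sphere_def busemann_ray[OF \<omega>])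
    then show ?thesis by (auto simp: sphere_def)
  qed
  show ?thesis
    unfolding *[OF \<omega>] *[OF \<omega>']
    using card_sphere_inter[OF v0 ray_in[OF \<omega>] v0 ray_in[OF \<omega>']] gdist_ray \<omega> \<omega>' by auto
qed

section \<open>Horocyclic sums of radial functions and the Abel transform\<close>

definition support :: "('a \<Rightarrow> complex) \<Rightarrow> 'a set" where
  "support f = {x \<in> V. f x \<noteq> 0}"

lemma horocycle_sum_indep:
  assumes v0: "v0 \<in> V" and f: "f \<in> radial_fin V E k v0"
    and \<omega>: "\<omega> \<in> rays V E k v0" and \<omega>': "\<omega>' \<in> rays V E k v0"
  shows "(\<Sum>x | x \<in> support f \<and> busemann V E k v0 x \<omega> = h. f x)
       = (\<Sum>x | x \<in> support f \<and> busemann V E k v0 x \<omega>' = h. f x)"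
proof -
  have fin: "finite (support f)"
    and rad: "\<And>x y. x \<in> V \<Longrightarrow> y \<in> V \<Longrightarrow> d x v0 = d y v0 \<Longrightarrow> f x = f y"
    using f unfolding radial_fin_def support_def by blast+
  define D where "D = (\<lambda>x. d x v0) ` support f"
  \<comment> \<open>\<open>c\<close> is the radial profile of \<open>f\<close>. At a distance that
    no vertex attains its value is arbitrary, but \<open>D\<close> contains no such
    distance.\<close>
  define c where "c n = f (SOME x. x \<in> V \<and> d x v0 = n)" for n
  have c: "f x = c (d x v0)" if "x \<in> V" for x
  proof -
    have "(SOME y. y \<in> V \<and> d y v0 = d x v0) \<in> V \<and> d (SOME y. y \<in> V \<and> d y v0 = d x v0) v0 = d x v0"
      by (rule someI[of _ x]) (use that in simp)
    then show ?thesis unfolding c_def by (intro rad that) simp_all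
  qed
  have *: "(\<Sum>x | x \<in> support f \<and> busemann V E k v0 x \<omega> = h. f x)
      = (\<Sum>n\<in>D. of_nat (card {x \<in> sphere v0 n. busemann V E k v0 x \<omega> = h}) * c n)" for \<omega>
  proof -
    let ?S = "{x \<in> support f. busemann V E k v0 x \<omega> = h}"
    have "(\<Sum>x\<in>?S. f x) = (\<Sum>n\<in>D. \<Sum>x | x \<in> ?S \<and> d x v0 = n. f x)"
      by (rule sum.group[symmetric]) (use fin in \<open>auto simp: D_def\<close>)
    also have "\<dots> = (\<Sum>n\<in>D. of_nat (card {x \<in> sphere v0 n. busemann V E k v0 x \<omega> = h}) * c n)"
    proof (rule sum.cong)
      fix n assume "n \<in> D"
      \<comment> \<open>Since \<open>c n\<close> is nonzero, the whole sphere of radius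
        \<open>n\<close> lies in the support, so restricting to the support drops nothing.\<close>
      then have "c n \<noteq> 0" using c by (auto simp: D_def support_def)
      then have "{x. x \<in> ?S \<and> d x v0 = n} = {x \<in> sphere v0 n. busemann V E k v0 x \<omega> = h}"
        using c gdist_commute[OF v0] by (auto simp: support_def sphere_def)
      moreover have "f x = c n" if "x \<in> sphere v0 n" for x
        using that c[of x] gdist_commute[OF v0, of x] by (simp add: sphere_def)
      ultimately show "(\<Sum>x | x \<in> ?S \<and> d x v0 = n. f x)
          = of_nat (card {x \<in> sphere v0 n. busemann V E k v0 x \<omega> = h}) * c n"
        by simp
    qed simp
    finally show ?thesis by simp
  qed
  show ?thesis unfolding * using card_sphere_horocycle[OF v0 \<omega> \<omega>'] by simp
qed

lemma abel_ray:
  assumes v0: "v0 \<in> V" and f: "f \<in> radial_fin V E k v0" and \<omega>: "\<omega> \<in> rays V E k v0"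
  shows "abel V E k r v0 f h = of_real (real Q powr (of_int h / 2)) *
      (\<Sum>x | x \<in> support f \<and> busemann V E k v0 x \<omega> = h. f x)" (is "_ = ?R")
proof -
  have fin: "finite (support f)" using f by (simp add: radial_fin_def support_def)
  have sum: "(\<Sum>\<^sub>\<infinity>x\<in>horocycle V E k v0 h \<omega>. f x)
      = (\<Sum>x | x \<in> support f \<and> busemann V E k v0 x \<omega> = h. f x)" for \<omega>
  proof -
    have "(\<Sum>\<^sub>\<infinity>x\<in>horocycle V E k v0 h \<omega>. f x)
        = (\<Sum>\<^sub>\<infinity>x\<in>{x. x \<in> support f \<and> busemann V E k v0 x \<omega> = h}. f x)"
      by (rule infsum_cong_neutral) (auto simp: horocycle_def support_def)
    then show ?thesis using fin by simp
  qed
  show ?thesis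
    unfolding abel_def sum
  \<comment> \<open>Existence is independence of the ray; uniqueness comes from evaluating at the
    given ray \<open>\<omega>\<close>.\<close>
  proof (rule the_equality)
    show "\<forall>\<omega>'\<in>rays V E k v0. ?R = of_real (real Q powr (of_int h / 2)) *
        (\<Sum>x | x \<in> support f \<and> busemann V E k v0 x \<omega>' = h. f x)"
      using horocycle_sum_indep[OF v0 f \<omega>, of _ h] by simp
  qed (use \<omega> in blast)
qed

section \<open>The Poisson kernel and integration over the boundary\<close>

lemma poisson_powr:
  assumes "busemann V E k v0 x \<omega> = h"
  shows "complex_of_real (poisson V E k r v0 x \<omega>) powr (1 / 2 + \<i> * \<mu>)
    = of_nat Q powr (\<i> * of_int h * \<mu>) * of_real (real Q powr (of_int h / 2))"
proof -
  define q where "q = real Q"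
  have q: "q > 0" using Q_pos by (simp add: q_def)
  \<comment> \<open>The base is a positive real, so its principal logarithm is
    \<open>h * ln q\<close>, and the exponent splits into the character of the integers and the
    factor of the Abel transform.\<close>
  have ln: "ln (q powi h) = of_int h * ln q"
    using q by (simp flip: powr_real_of_int' add: ln_powr)
  have "complex_of_real (q powi h) powr (1 / 2 + \<i> * \<mu>)
      = exp ((1 / 2 + \<i> * \<mu>) * of_real (of_int h * ln q))"
    using q ln by (simp add: powr_def Ln_of_real del: of_real_power_int of_real_mult)
  also have "\<dots> = exp ((\<i> * of_int h * \<mu>) * of_real (ln q)) * exp (of_real (of_int h / 2 * ln q))"
    by (simp add: algebra_simps flip: exp_add)
  also have "exp (of_real (of_int h / 2 * ln q)) = complex_of_real (q powr (of_int h / 2))"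
    using q by (simp add: powr_def flip: exp_of_real)
  also have "exp ((\<i> * of_int h * \<mu>) * of_real (ln q)) = complex_of_real q powr (\<i> * of_int h * \<mu>)"
    using q by (simp add: powr_def Ln_of_real)
  finally show ?thesis using assms by (simp add: poisson_def q_def)
qed

text \<open>The value at \<open>\<omega>\<close> depends only on the node of index
  \<open>d x v0 + 1\<close>, so each level set is a union of cylinders and thus open. The target is
  countable, so level sets suffice.\<close>

lemma measurable_busemann:
  assumes v0: "v0 \<in> V" and x: "x \<in> V" and \<nu>: "is_boundary_measure V E k r v0 \<nu>"
  shows "busemann V E k v0 x \<in> measurable \<nu> (count_space UNIV)"
proof -
  have space: "space \<nu> = rays V E k v0"
    and sets: "sets \<nu> = sigma_sets (rays V E k v0) {U. openin (boundary_topology V E k v0) U}"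
    using \<nu> by (auto simp: is_boundary_measure_def)
  have "busemann V E k v0 x -` {h} \<inter> space \<nu> \<in> sets \<nu>" for h
  proof -
    define m where "m = Suc (d x v0)"
    define Y where "Y = {y \<in> V. d y v0 = m \<and> int m - int (d x y) = h}"
    have "\<omega> \<in> busemann V E k v0 x -` {h} \<inter> space \<nu>
        \<longleftrightarrow> \<omega> \<in> (\<Union>y\<in>Y. ray_cylinder V E k v0 y)" for \<omega>
    proof (cases "\<omega> \<in> rays V E k v0")
      case True
      have "d (\<omega> m) v0 = m" using gdist_commute[OF v0 ray_in] gdist_ray True by metis
      then show ?thesis
        using True ray_in[OF True]
        by (auto simp: space ray_cylinder_def Y_def busemann_ray m_def simp del: of_nat_Suc)
    qed (auto simp: space ray_cylinder_def)
    then have "busemann V E k v0 x -` {h} \<inter> space \<nu> = (\<Union>y\<in>Y. ray_cylinder V E k v0 y)"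
      by blast
    moreover have "openin (boundary_topology V E k v0) (\<Union>y\<in>Y. ray_cylinder V E k v0 y)"
      unfolding boundary_topology_def
      by (intro openin_Union) (auto simp: Y_def intro!: topology_generated_by_Basis)
    ultimately show ?thesis by (simp add: sets sigma_sets.Basic)
  qed
  then show ?thesis by (simp add: measurable_count_space_eq2_countable)
qed

lemma integrable_busemann:
  fixes g :: "int \<Rightarrow> complex"
  assumes v0: "v0 \<in> V" and x: "x \<in> V" and \<nu>: "is_boundary_measure V E k r v0 \<nu>"
  shows "integrable \<nu> (\<lambda>\<omega>. g (busemann V E k v0 x \<omega>))"
proof -
  interpret prob_space \<nu> using \<nu> by (simp add: is_boundary_measure_def)
  have space: "space \<nu> = rays V E k v0" using \<nu> by (simp add: is_boundary_measure_def)
  let ?I = "{- int (d x v0)..int (d x v0)}"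
  show ?thesis
  proof (rule integrable_const_bound)
    \<comment> \<open>The constant is the sum of the norms over all possible values, which dominates
      each of them.\<close>
    show "AE \<omega> in \<nu>. norm (g (busemann V E k v0 x \<omega>)) \<le> (\<Sum>h\<in>?I. norm (g h))"
    proof (rule AE_I2)
      fix \<omega> assume "\<omega> \<in> space \<nu>"
      then have "busemann V E k v0 x \<omega> \<in> ?I"
        using busemann_bound[OF v0 x] space by (simp add: abs_le_iff) fastforce
      then show "norm (g (busemann V E k v0 x \<omega>)) \<le> (\<Sum>h\<in>?I. norm (g h))"
        by (intro member_le_sum) auto
    qed
    show "(\<lambda>\<omega>. g (busemann V E k v0 x \<omega>)) \<in> borel_measurable \<nu>"
      using measurable_compose[OF measurable_busemann[OF assms], of g borel] by simp
  qed
qed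

text \<open>Group the finite support by the value of the Busemann function. The right-hand side does
  not mention the ray, so the sum under the integral is constant on the boundary.\<close>

lemma sum_poisson_ray:
  assumes v0: "v0 \<in> V" and f: "f \<in> radial_fin V E k v0" and \<omega>: "\<omega> \<in> rays V E k v0"
  shows "(\<Sum>x\<in>support f. f x * complex_of_real (poisson V E k r v0 x \<omega>) powr (1 / 2 + \<i> * \<mu>))
       = fourier_int Q (abel V E k r v0 f) \<mu>"
proof -
  have fin: "finite (support f)" using f by (simp add: radial_fin_def support_def)
  define B where "B = (\<lambda>x. busemann V E k v0 x \<omega>) ` support f"
  have "fourier_int Q (abel V E k r v0 f) \<mu>
      = (\<Sum>\<^sub>\<infinity>h\<in>B. of_nat Q powr (\<i> * of_int h * \<mu>) * abel V E k r v0 f h)"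
    unfolding fourier_int_def
  proof (rule infsum_cong_neutral)
    \<comment> \<open>Levels that the support misses have an empty horocyclic sum, which makes the
      Fourier sum finite.\<close>
    fix h assume "h \<in> UNIV - B"
    then have "{x. x \<in> support f \<and> busemann V E k v0 x \<omega> = h} = {}" by (auto simp: B_def)
    then show "of_nat Q powr (\<i> * of_int h * \<mu>) * abel V E k r v0 f h = 0"
      by (simp add: abel_ray[OF assms] del: Collect_empty_eq)
  qed auto
  also have "\<dots> = (\<Sum>h\<in>B. of_nat Q powr (\<i> * of_int h * \<mu>) * abel V E k r v0 f h)"
    using fin by (simp add: B_def)
  also have "\<dots> = (\<Sum>h\<in>B. \<Sum>x | x \<in> support f \<and> busemann V E k v0 x \<omega> = h.
      f x * complex_of_real (poisson V E k r v0 x \<omega>) powr (1 / 2 + \<i> * \<mu>))"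
  proof (rule sum.cong)
    fix h
    show "of_nat Q powr (\<i> * of_int h * \<mu>) * abel V E k r v0 f h
        = (\<Sum>x | x \<in> support f \<and> busemann V E k v0 x \<omega> = h.
            f x * complex_of_real (poisson V E k r v0 x \<omega>) powr (1 / 2 + \<i> * \<mu>))"
      unfolding abel_ray[OF assms] sum_distrib_left
      by (intro sum.cong) (auto simp: poisson_powr)
  qed simp
  also have "\<dots> = (\<Sum>x\<in>support f. f x * complex_of_real (poisson V E k r v0 x \<omega>) powr (1 / 2 + \<i> * \<mu>))"
    by (rule sum.group) (use fin in \<open>auto simp: B_def\<close>)
  finally show ?thesis by simp
qed

lemma spherical_transform_eq_fourier_abel:
  assumes v0: "v0 \<in> V" and \<nu>: "is_boundary_measure V E k r v0 \<nu>"
    and f: "f \<in> radial_fin V E k v0"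
  shows "spherical_transform V E k r v0 \<nu> f \<mu> = fourier_int Q (abel V E k r v0 f) \<mu>"
proof -
  interpret prob_space \<nu> using \<nu> by (simp add: is_boundary_measure_def)
  have space: "space \<nu> = rays V E k v0" using \<nu> by (simp add: is_boundary_measure_def)
  have fin: "finite (support f)" using f by (simp add: radial_fin_def support_def)
  let ?p = "\<lambda>x \<omega>. complex_of_real (poisson V E k r v0 x \<omega>) powr (1 / 2 + \<i> * \<mu>)"
  have int: "integrable \<nu> (?p x)" if "x \<in> V" for x
    unfolding poisson_def by (rule integrable_busemann[OF v0 that \<nu>])
  have "spherical_transform V E k r v0 \<nu> f \<mu>
      = (\<Sum>\<^sub>\<infinity>x\<in>support f. f x * spherical V E k r v0 \<nu> \<mu> x)"
    unfolding spherical_transform_def by (rule infsum_cong_neutral) (auto simp: support_def)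
  also have "\<dots> = (\<Sum>x\<in>support f. \<integral>\<omega>. f x * ?p x \<omega> \<partial>\<nu>)"
    using fin by (simp add: spherical_def)
  \<comment> \<open>The support is finite, so the exchange is plain linearity of the
    integral.\<close>
  also have "\<dots> = (\<integral>\<omega>. (\<Sum>x\<in>support f. f x * ?p x \<omega>) \<partial>\<nu>)"
    using int by (intro Bochner_Integration.integral_sum[symmetric]) (auto simp: support_def)
  also have "\<dots> = (\<integral>\<omega>. fourier_int Q (abel V E k r v0 f) \<mu> \<partial>\<nu>)"
    using sum_poisson_ray[OF v0 f] space by (intro Bochner_Integration.integral_cong) auto
  also have "\<dots> = fourier_int Q (abel V E k r v0 f) \<mu>" by (simp add: prob_space)
  finally show ?thesis .
qed

end

theorem mainTheorem9:
  fixes V :: "'a set" and E :: "'a set set" and k r :: nat and v0 :: 'a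
    and \<nu> :: "(nat \<Rightarrow> 'a) measure" and f :: "'a \<Rightarrow> complex" and \<mu> :: complex
  assumes "k \<ge> 2" and "r \<ge> 2"
    and "symmetric_graph V E k r" and "v0 \<in> V"
    and "is_boundary_measure V E k r v0 \<nu>"
    and "f \<in> radial_fin V E k v0"
  shows "spherical_transform V E k r v0 \<nu> f \<mu> =
         fourier_int (branching k r) (abel V E k r v0 f) \<mu>"
proof -
  interpret symmetric_graph V E k r by fact
  interpret nondegenerate_symmetric_graph V E k r by unfold_locales fact+
  show ?thesis using assms(4-6) by (rule spherical_transform_eq_fourier_abel)
qed

end
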